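(* If integers $n,m\geq 2$ are not relatively prime, then there is $x\in I$ such that $T_n\circ T_m^{-1}(x)\subsetneq T_m^{-1}\circ T_n(x)$.
   Context: $I=[0,1]$. For an integer $n\ge 2$, the symmetric $n$-tent map $T_n\colon I\to I$ is the continuous map with $T_n(i/n)=0$ for even $i\in\{0,\ldots,n\}$, $T_n(i/n)=1$ for odd $i\in\{0,\ldots,n\}$, and linear on each interval $[\frac in,\frac{i+1}n]$, $i\in\{0,\ldots,n-1\}$. For maps $f,g\colon I\to I$ and $x\in I$, $f\circ g^{-1}(x)=\{f(y): y\in I,\ g(y)=x\}$ and $g^{-1}\circ f(x)=\{z\in I: g(z)=f(x)\}$. *)

theory Defs
  imports "HOL-Analysis.Analysis"
begin

abbreviation I :: "real set" where
  "I \<equiv> {0..1}"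

text \<open>``Linear'' on an interval means affine. The conditions determine \<open>T\<close> only on \<open>I\<close>;
  values outside \<open>I\<close> are junk and are never used.\<close>

definition symmetric_tent_map :: "nat \<Rightarrow> (real \<Rightarrow> real) \<Rightarrow> bool" where
  "symmetric_tent_map n T \<longleftrightarrow>
     T ` I \<subseteq> I \<and>
     continuous_on I T \<and>
     (\<forall>i\<in>{0..n}. even i \<longrightarrow> T (real i / real n) = 0) \<and>
     (\<forall>i\<in>{0..n}. odd i \<longrightarrow> T (real i / real n) = 1) \<and>
     (\<forall>i\<in>{0..<n}. \<exists>a b. \<forall>x\<in>{real i / real n..real (i + 1) / real n}. T x = a * x + b)"

definition comp_inv :: "(real \<Rightarrow> real) \<Rightarrow> (real \<Rightarrow> real) \<Rightarrow> real \<Rightarrow> real set" where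
  "comp_inv f g x = {f y |y. y \<in> I \<and> g y = x}"

definition inv_comp :: "(real \<Rightarrow> real) \<Rightarrow> (real \<Rightarrow> real) \<Rightarrow> real \<Rightarrow> real set" where
  "inv_comp g f x = {z \<in> I. g z = f x}"

text \<open>For \<open>n \<ge> 1\<close> there is exactly one symmetric \<open>n\<close>-tent map, up to its values outside \<open>I\<close>.\<close>

lemma interval_index:
  assumes "n \<ge> 1" "x \<in> I"
  obtains i where "i < n" "x \<in> {real i / real n..real (i + 1) / real n}"
proof (cases "x = 1")
  case True
  then show ?thesis
    using assms by (intro that[of "n - 1"]) (auto simp: field_simps of_nat_diff)
next
  case False
  define i where "i = nat \<lfloor>real n * x\<rfloor>"
  have ge: "real n * x \<ge> 0" using assms by simp
  have lt: "real n * x < real n" using assms False by simp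
  have i: "real i \<le> real n * x" "real n * x < real i + 1"
    unfolding i_def using ge by linarith+
  show ?thesis
  proof (rule that[of i])
    show "i < n" using i lt by linarith
    show "x \<in> {real i / real n..real (i + 1) / real n}"
      using i assms by (auto simp: field_simps)
  qed
qed

lemma symmetric_tent_map_on_interval:
  assumes "symmetric_tent_map n T" "i < n" "x \<in> {real i / real n..real (i + 1) / real n}"
  shows "T x = (if even i then real n * x - real i else 1 - (real n * x - real i))"
proof -
  have n: "real n > 0" using assms by simp
  obtain a b where ab: "\<And>y. y \<in> {real i / real n..real (i + 1) / real n} \<Longrightarrow> T y = a * y + b"
  proof -
    have "\<exists>a b. \<forall>y\<in>{real i / real n..real (i + 1) / real n}. T y = a * y + b"
      using assms(1,2) unfolding symmetric_tent_map_def by simp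
    then show ?thesis using that by blast
  qed
  have nodes: "T (real j / real n) = (if even j then 0 else 1)" if "j \<le> n" for j
    using assms(1) that unfolding symmetric_tent_map_def by simp
  have l: "T (real i / real n) = (if even i then 0 else 1)"
    using nodes[of i] assms(2) by simp
  have r: "T (real (i + 1) / real n) = (if even i then 1 else 0)"
    using nodes[of "i + 1"] assms(2) by (simp del: of_nat_add)
  have l': "a * (real i / real n) + b = (if even i then 0 else 1)"
    using ab[of "real i / real n"] l n by (simp add: divide_right_mono)
  have r': "a * (real (i + 1) / real n) + b = (if even i then 1 else 0)"
    using ab[of "real (i + 1) / real n"] r n by (simp add: divide_right_mono)
  have "a / real n = a * (real (i + 1) / real n) + b - (a * (real i / real n) + b)"
    using n by (simp add: field_simps)
  then have "a / real n = (if even i then 1 else -1)"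
    unfolding l' r' by auto
  then have a: "a = (if even i then real n else - real n)"
    using n by (auto simp: field_simps split: if_splits)
  have "b = (if even i then - real i else 1 + real i)"
    using l' a n by (auto split: if_splits)
  then show ?thesis
    using ab[OF assms(3)] a by auto
qed

lemma symmetric_tent_map_unique:
  assumes "n \<ge> 1" "symmetric_tent_map n S" "symmetric_tent_map n T" "x \<in> I"
  shows "S x = T x"
proof (rule interval_index[OF assms(1,4)])
  fix i assume i: "i < n" "x \<in> {real i / real n..real (i + 1) / real n}"
  show "S x = T x"
    unfolding symmetric_tent_map_on_interval[OF assms(2) i]
      symmetric_tent_map_on_interval[OF assms(3) i] ..
qed

lemma symmetric_tent_map_exists:
  assumes "n \<ge> 1"
  shows "\<exists>T. symmetric_tent_map n T"
proof -
  define T where "T x = 1 - \<bar>real n * x - 2 * of_int \<lfloor>real n * x / 2\<rfloor> - 1\<bar>" for x :: real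
  have n: "real n > 0" using assms by simp
  have piece: "T x = (if even i then real n * x - real i else 1 - (real n * x - real i))"
    if "x \<in> {real i / real n..real (i + 1) / real n}" for i x
  proof -
    have b: "real i \<le> real n * x" "real n * x \<le> real i + 1"
      using that n by (auto simp: field_simps)
    show ?thesis
    proof (cases "even i")
      case True
      then obtain k where k: "i = 2 * k" by blast
      have "\<lfloor>real n * x / 2\<rfloor> = int k" using b k by (intro floor_unique) auto
      then show ?thesis using b k by (simp add: T_def)
    next
      case False
      then obtain k where k: "i = 2 * k + 1" using oddE by blast
      show ?thesis
      proof (cases "real n * x = real i + 1")
        case True
        then have "\<lfloor>real n * x / 2\<rfloor> = int k + 1" using k by (intro floor_unique) auto
        then show ?thesis using True k by (simp add: T_def)
      next
        case False
        then have "\<lfloor>real n * x / 2\<rfloor> = int k" using b k by (intro floor_unique) auto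
        then show ?thesis using b k by (simp add: T_def)
      qed
    qed
  qed
  have left: "real i / real n \<in> {real i / real n..real (i + 1) / real n}" for i
    using n by (simp add: divide_right_mono)
  have "T ` I \<subseteq> I"
  proof (intro image_subsetI)
    fix x :: real assume "x \<in> I"
    then obtain i where i: "x \<in> {real i / real n..real (i + 1) / real n}"
      by (rule interval_index[OF assms])
    have "real i \<le> real n * x" "real n * x \<le> real i + 1"
      using i n by (auto simp: field_simps)
    then show "T x \<in> I" using piece[OF i] by auto
  qed
  moreover have "continuous_on I T"
  proof -
    have "continuous_on (\<Union>i\<in>{..<n}. {real i / real n..real (i + 1) / real n}) T"
    proof (rule continuous_on_closed_Union)
      fix i assume "i \<in> {..<n}"
      have "continuous_on {real i / real n..real (i + 1) / real n}
          (\<lambda>x. if even i then real n * x - real i else 1 - (real n * x - real i))"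
        by (cases "even i") (auto intro!: continuous_intros)
      then show "continuous_on {real i / real n..real (i + 1) / real n} T"
        using piece by (subst continuous_on_cong[OF refl]) auto
    qed auto
    moreover have "I \<subseteq> (\<Union>i\<in>{..<n}. {real i / real n..real (i + 1) / real n})"
    proof
      fix x :: real assume "x \<in> I"
      then obtain i where "i < n" "x \<in> {real i / real n..real (i + 1) / real n}"
        by (rule interval_index[OF assms])
      then show "x \<in> (\<Union>i\<in>{..<n}. {real i / real n..real (i + 1) / real n})"
        by blast
    qed
    ultimately show ?thesis by (rule continuous_on_subset)
  qed
  moreover have "T (real i / real n) = (if even i then 0 else 1)" for i
    using piece[OF left, of i] n by simp
  moreover have "\<exists>a b. \<forall>x\<in>{real i / real n..real (i + 1) / real n}. T x = a * x + b" for i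
  proof (cases "even i")
    case True
    then show ?thesis
      using piece by (intro exI[of _ "real n"] exI[of _ "- real i"]) auto
  next
    case False
    then show ?thesis
      using piece by (intro exI[of _ "- real n"] exI[of _ "1 + real i"]) auto
  qed
  ultimately have "symmetric_tent_map n T"
    unfolding symmetric_tent_map_def by auto
  then show ?thesis by blast
qed

end

theory Submission
  imports Defs
begin

text \<open>
  On \<open>I\<close> the map \<open>T\<^sub>n\<close> sends \<open>y\<close> to the unique \<open>t \<in> I\<close> that lies in the orbit of \<open>n y\<close> under
  the group of isometries generated by \<open>u \<mapsto> -u\<close> and \<open>u \<mapsto> u + 2\<close>. Multiplication by an integer
  respects these orbits, which gives the inclusion for every \<open>x\<close>. For strictness take
  \<open>x = 1/(2n)\<close> and \<open>z = 3/(2m)\<close>: then \<open>T\<^sub>m z = 1/2 = T\<^sub>n x\<close>, but \<open>T\<^sub>m y = x\<close> and \<open>T\<^sub>n y = z\<close> would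
  place \<open>n m y\<close> in both \<open>\<plusminus>1/2 + 2n\<int>\<close> and \<open>\<plusminus>3/2 + 2m\<int>\<close>, whence \<open>k n - l m = \<plusminus>1\<close> for some
  integers \<open>k, l\<close>, against \<open>gcd n m > 1\<close>.
\<close>

text \<open>The orbit relation of an infinite dihedral group acting on the reals, with
  \<open>I\<close> as a fundamental domain.\<close>

definition refl_cong :: "real \<Rightarrow> real \<Rightarrow> bool" where
  "refl_cong u v \<longleftrightarrow> (\<exists>k::int. u = v + 2 * of_int k \<or> u = - v + 2 * of_int k)"

lemma refl_cong_sym:
  assumes "refl_cong u v"
  shows "refl_cong v u"
proof -
  obtain k :: int where "u = v + 2 * of_int k \<or> u = - v + 2 * of_int k"
    using assms unfolding refl_cong_def by blast
  then have "v = u + 2 * of_int (- k) \<or> v = - u + 2 * of_int k"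
    by auto
  then show ?thesis
    unfolding refl_cong_def by blast
qed

lemma refl_cong_trans:
  assumes "refl_cong u v" "refl_cong v w"
  shows "refl_cong u w"
proof -
  obtain k l :: int where "u = v + 2 * of_int k \<or> u = - v + 2 * of_int k"
      "v = w + 2 * of_int l \<or> v = - w + 2 * of_int l"
    using assms unfolding refl_cong_def by blast
  then have "u = w + 2 * of_int (k + l) \<or> u = - w + 2 * of_int (k + l) \<or>
      u = w + 2 * of_int (k - l) \<or> u = - w + 2 * of_int (k - l)"
    by auto
  then show ?thesis
    unfolding refl_cong_def by blast
qed

text \<open>Keeps the translation visible as a multiple of \<open>2 * n\<close>.
  \<open>refl_cong_mult\<close> forgets this, but the divisibility argument for strictness rests on
  it.\<close>

lemma refl_cong_multE:
  assumes "refl_cong u v"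
  obtains k :: int where
    "real n * u = real n * v + 2 * of_int (k * int n) \<or>
     real n * u = - (real n * v) + 2 * of_int (k * int n)"
proof -
  obtain k :: int where "u = v + 2 * of_int k \<or> u = - v + 2 * of_int k"
    using assms unfolding refl_cong_def by blast
  then have "real n * u = real n * (v + 2 * of_int k) \<or>
      real n * u = real n * (- v + 2 * of_int k)"
    by metis
  then show ?thesis
    by (intro that[of k]) (simp add: algebra_simps)
qed

lemma refl_cong_mult:
  assumes "refl_cong u v"
  shows "refl_cong (real n * u) (real n * v)"
  using assms by (rule refl_cong_multE[of u v n]) (unfold refl_cong_def, blast)

lemma refl_cong_unit_interval_eq:
  assumes "refl_cong s t" "s \<in> I" "t \<in> I"
  shows "s = t"
proof -
  obtain k :: int where k: "s = t + 2 * of_int k \<or> s = - t + 2 * of_int k"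
    using assms unfolding refl_cong_def by blast
  \<comment> \<open>\<open>2 * k\<close> is \<open>s - t\<close> or \<open>s + t\<close>, so it lies
    in [-1, 2]; the case \<open>k = 1\<close> survives only at \<open>s = t = 1\<close>.\<close>
  then have "-1 < real_of_int k" "real_of_int k < 2"
    using assms(2,3) by auto
  then have "k = 0 \<or> k = 1"
    by linarith
  then show ?thesis
    using k assms(2,3) by auto
qed

lemma symmetric_tent_map_in_I:
  assumes "symmetric_tent_map n T" "y \<in> I"
  shows "T y \<in> I"
  using assms(1) imageI[OF assms(2), of T] unfolding symmetric_tent_map_def by blast

text \<open>The translation is by \<open>i\<close> on a rising piece and by \<open>i + 1\<close> on
  a falling one, both even.\<close>

lemma symmetric_tent_map_refl_cong:
  assumes "symmetric_tent_map n T" "n \<ge> 1" "y \<in> I"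
  shows "refl_cong (real n * y) (T y)"
proof (rule interval_index[OF assms(2,3)])
  fix i assume i: "i < n" "y \<in> {real i / real n..real (i + 1) / real n}"
  note T = symmetric_tent_map_on_interval[OF assms(1) i]
  show ?thesis
  proof (cases "even i")
    case True
    then obtain k where "i = 2 * k" by blast
    then have "real n * y = T y + 2 * of_int (int k)"
      using T by simp
    then show ?thesis
      unfolding refl_cong_def by blast
  next
    case False
    then obtain k where "i = 2 * k + 1" using oddE by blast
    then have "real n * y = - T y + 2 * of_int (int k + 1)"
      using T by simp
    then show ?thesis
      unfolding refl_cong_def by blast
  qed
qed

lemma symmetric_tent_map_eq_iff:
  assumes "symmetric_tent_map n T" "n \<ge> 1" "y \<in> I" "t \<in> I"
  shows "T y = t \<longleftrightarrow> refl_cong (real n * y) t"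
proof
  assume "T y = t"
  then show "refl_cong (real n * y) t"
    using symmetric_tent_map_refl_cong[OF assms(1-3)] by simp
next
  assume "refl_cong (real n * y) t"
  then have "refl_cong (T y) t"
    using symmetric_tent_map_refl_cong[OF assms(1-3)] refl_cong_sym refl_cong_trans by blast
  moreover have "T y \<in> I"
    by (rule symmetric_tent_map_in_I[OF assms(1,3)])
  ultimately show "T y = t"
    using refl_cong_unit_interval_eq assms(4) by blast
qed

lemma comp_inv_subset_inv_comp:
  assumes "symmetric_tent_map n S" "symmetric_tent_map m T" "n \<ge> 1" "m \<ge> 1" "x \<in> I"
  shows "comp_inv S T x \<subseteq> inv_comp T S x"
proof
  fix z assume "z \<in> comp_inv S T x"
  then obtain y where y: "y \<in> I" "T y = x" "z = S y"
    unfolding comp_inv_def by blast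
  have SI: "S y \<in> I" "S x \<in> I"
    by (rule symmetric_tent_map_in_I[OF assms(1)], fact)+
  \<comment> \<open>The point \<open>m * n * y\<close> is the link: its orbit contains both
    \<open>m * S y\<close> and \<open>n * T y\<close>.\<close>
  have "refl_cong (real m * z) (real m * (real n * y))"
    unfolding y(3)
    by (intro refl_cong_mult refl_cong_sym[OF symmetric_tent_map_refl_cong] assms y(1))
  moreover have "refl_cong (real m * (real n * y)) (real n * x)"
    unfolding y(2)[symmetric] mult.left_commute[of "real m"]
    by (intro refl_cong_mult symmetric_tent_map_refl_cong assms y(1))
  moreover have "refl_cong (real n * x) (S x)"
    by (rule symmetric_tent_map_refl_cong[OF assms(1,3,5)])
  ultimately have "refl_cong (real m * z) (S x)"
    using refl_cong_trans by blast
  then have "T z = S x"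
    using symmetric_tent_map_eq_iff[OF assms(2,4)] SI y(3) by blast
  then show "z \<in> inv_comp T S x"
    using SI y(3) unfolding inv_comp_def by blast
qed

theorem proposition3p4:
  fixes n m :: nat and Tn Tm :: "real \<Rightarrow> real"
  assumes "n \<ge> 2" and "m \<ge> 2"
    and "\<not> coprime n m"
    and "symmetric_tent_map n Tn" and "symmetric_tent_map m Tm"
  shows "\<exists>x\<in>I. comp_inv Tn Tm x \<subset> inv_comp Tm Tn x"
proof -
  have n1: "n \<ge> 1" and m1: "m \<ge> 1"
    using assms by auto
  \<comment> \<open>Since 3/2 = -1/2 + 2, the points \<open>n * x\<close> and \<open>m * z\<close>
    share the orbit of 1/2; \<open>m \<ge> 2\<close> keeps \<open>z\<close> inside
    \<open>I\<close>.\<close>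
  define x z :: real where "x = 1 / (2 * real n)" and "z = 3 / (2 * real m)"
  have nx: "real n * x = 1/2" and mz: "real m * z = 3/2"
    using assms(1,2) unfolding x_def z_def by auto
  have xI: "x \<in> I" and zI: "z \<in> I"
    using assms(1,2) unfolding x_def z_def by (auto simp: field_simps)
  have "refl_cong (1/2) (1/2)"
    unfolding refl_cong_def by (intro exI[of _ 0]) simp
  then have "Tn x = 1/2"
    using symmetric_tent_map_eq_iff[OF assms(4) n1 xI, of "1/2"] nx by simp
  moreover have "refl_cong (3/2) (1/2)"
    unfolding refl_cong_def by (intro exI[of _ 1]) simp
  then have "Tm z = 1/2"
    using symmetric_tent_map_eq_iff[OF assms(5) m1 zI, of "1/2"] mz by simp
  ultimately have "z \<in> inv_comp Tm Tn x"
    using zI unfolding inv_comp_def by simp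
  moreover have "z \<notin> comp_inv Tn Tm x"
  proof
    assume "z \<in> comp_inv Tn Tm x"
    then obtain y where y: "y \<in> I" "Tm y = x" "Tn y = z"
      unfolding comp_inv_def by blast
    have "refl_cong (real m * y) x"
      using symmetric_tent_map_refl_cong[OF assms(5) m1 y(1)] y(2) by simp
    then obtain k :: int where
      "real n * (real m * y) = 1/2 + 2 * of_int (k * int n) \<or>
       real n * (real m * y) = - (1/2) + 2 * of_int (k * int n)"
      by (rule refl_cong_multE[of _ x n, unfolded nx])
    moreover have "refl_cong (real n * y) z"
      using symmetric_tent_map_refl_cong[OF assms(4) n1 y(1)] y(3) by simp
    then obtain l :: int where
      "real m * (real n * y) = 3/2 + 2 * of_int (l * int m) \<or>
       real m * (real n * y) = - (3/2) + 2 * of_int (l * int m)"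
      by (rule refl_cong_multE[of _ z m, unfolded mz])
    moreover have "real n * (real m * y) = real m * (real n * y)"
      by simp
    \<comment> \<open>Equal signs would make this integer 1/2 or -1/2, so the signs are opposite and
      the difference is 1 or -1.\<close>
    ultimately have "k * int n - l * int m = 1 \<or> k * int n - l * int m = -1"
      by linarith
    moreover have "int (gcd n m) dvd k * int n - l * int m"
      by (intro dvd_diff dvd_mult) auto
    ultimately have "int (gcd n m) dvd 1"
      by (metis dvd_minus_iff)
    then show False
      using assms(3) by (simp add: coprime_iff_gcd_eq_1)
  qed
  ultimately show ?thesis
    using comp_inv_subset_inv_comp[OF assms(4,5) n1 m1 xI] xI by blast
qed

end
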